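(* Let $A_1$ and $B_1$ be real symmetric matrices of order $n$, indexed by a set $V$. Let $e_1,\dots,e_p$ be zero-one vectors of length $n$ with pairwise disjoint supports, $J_{i,j}=e_ie_j^\top$ for $1\le i,j\le p$, $k=1+p^2$, $\mathbf A=(A_1,J_{1,1},J_{1,2},\dots,J_{p,p})$ and $\mathbf B=(B_1,J_{1,1},J_{1,2},\dots,J_{p,p})$. If $I_{W_{\mathbf A}(\mathbf s),2}(t)=I_{W_{\mathbf B}(\mathbf s),2}(t)$, then $\phi_{\mathbf A}(\mathbf s;t)=\phi_{\mathbf B}(\mathbf s;t)$.
   Context: $\mathbf s=(s_1,\dots,s_k)$ is a tuple of variables; $W_{\mathbf A}(\mathbf s)=\sum_is_iA_i$ (a matrix $V\times V$ with entries in the polynomial ring $\mathbb C[\mathbf s]$) and $\phi_{\mathbf A}(\mathbf s;t)=\det(tI-W_{\mathbf A}(\mathbf s))$. WL invariants of a matrix $M:V\times V\to C$: the atomic type $\mathrm{tp}_M(i_1,\dots,i_k)$ is the $k\times k$ array $T$ with $T_{a,b}=(0,M(i_a,i_b))$ if $i_a=i_b$ and $(1,M(i_a,i_b))$ otherwise; $X^1_{M,2}=\mathrm{tp}_M$ on pairs and $X^{r+1}_{M,2}(i,j)=\big(X^r_{M,2}(i,j),\{\!\{(\mathrm{tp}_M(i,j,m),X^r_{M,2}(i,m),X^r_{M,2}(m,j)):m\in V\}\!\}\big)$ ($\{\!\{\cdot\}\!\}$ a multiset; colors are abstract objects built this way, comparable across matrices). $M^r_{M,2}=\{\!\{X^r_{M,2}(x):x\in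 V^2\}\!\}$ and $I_{M,2}(t)=\sum_{r\ge1}t^rM^r_{M,2}$ as a formal series. *)

theory Defs
  imports
    "HOL-Analysis.Determinants"
    "HOL-Library.Multiset"
    "HOL-Library.Poly_Mapping"
    "HOL-Computational_Algebra.Polynomial"
    "HOL-Computational_Algebra.Formal_Power_Series"
begin

text \<open>
  Matrices indexed by a finite set \<open>V\<close> are matrices over a finite index type \<open>'v\<close>; their order
  \<open>n\<close> is \<open>CARD('v)\<close>.

  Multivariate polynomials are monoid algebras: a monomial is a finitely supported exponent map.
  The variables are \<open>s\<^sub>0, s\<^sub>1, \<dots>\<close>; a tuple of \<open>k\<close> matrices only involves the first \<open>k\<close> of them,
  that is, the subring \<open>\<complex>[s\<^sub>0, \<dots>, s\<^bsub>k-1\<^esub>]\<close>.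
\<close>

type_synonym 'a mpol = "(nat \<Rightarrow>\<^sub>0 nat) \<Rightarrow>\<^sub>0 'a"

definition mvar :: "nat \<Rightarrow> 'a::comm_ring_1 mpol" where
  "mvar i = Poly_Mapping.single (Poly_Mapping.single i 1) 1"

definition mconst :: "'a::comm_ring_1 \<Rightarrow> 'a mpol" where
  "mconst c = Poly_Mapping.single 0 c"

definition pencil :: "(complex ^ 'v ^ 'v) list \<Rightarrow> complex mpol ^ 'v ^ 'v::finite" where
  "pencil As = (\<chi> a b. \<Sum>i<length As. mvar i * mconst (As ! i $ a $ b))"

definition pencil_charpoly :: "(complex ^ 'v ^ 'v::finite) list \<Rightarrow> complex mpol poly" where
  "pencil_charpoly As = det (mat [:0, 1:] - (\<chi> a b. [:pencil As $ a $ b:]))"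

definition atomic_type :: "'c ^ 'v ^ 'v::finite \<Rightarrow> 'v list \<Rightarrow> (nat \<times> 'c) list list" where
  "atomic_type M is = map (\<lambda>a. map (\<lambda>b. (if a = b then 0 else 1, M $ a $ b)) is) is"

text \<open>
  Colors are hereditary terms over the matrix entries and do not mention indices, so colors coming
  from different matrices can be compared by equality.
\<close>

datatype 'c wl_color =
    Atomic "(nat \<times> 'c) list list"
  | Refined "'c wl_color" "((nat \<times> 'c) list list \<times> 'c wl_color \<times> 'c wl_color) multiset"

text \<open>Rounds are numbered from 1; the value at round 0 is unspecified and never used.\<close>

fun wl2 :: "'c ^ 'v ^ 'v::finite \<Rightarrow> nat \<Rightarrow> 'v \<Rightarrow> 'v \<Rightarrow> 'c wl_color" where
  "wl2 M (Suc 0) i j = Atomic (atomic_type M [i, j])"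
| "wl2 M (Suc (Suc r)) i j =
     Refined (wl2 M (Suc r) i j)
       {# (atomic_type M [i, j, m], wl2 M (Suc r) i m, wl2 M (Suc r) m j). m \<in># mset_set UNIV #}"

definition wl2_multiset :: "'c ^ 'v ^ 'v::finite \<Rightarrow> nat \<Rightarrow> 'c wl_color multiset" where
  "wl2_multiset M r = {# wl2 M r (fst x) (snd x). x \<in># mset_set UNIV #}"

definition wl2_invariant :: "'c ^ 'v ^ 'v::finite \<Rightarrow> 'c wl_color multiset fps" where
  "wl2_invariant M = Abs_fps (\<lambda>r. if r = 0 then {#} else wl2_multiset M r)"

definition outer :: "real ^ 'v \<Rightarrow> real ^ 'v \<Rightarrow> real ^ 'v ^ 'v::finite" where
  "outer x y = (\<chi> a b. x $ a * y $ b)"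

definition complex_matrix :: "real ^ 'v ^ 'v \<Rightarrow> complex ^ 'v ^ 'v::finite" where
  "complex_matrix A = (\<chi> a b. complex_of_real (A $ a $ b))"

text \<open>The tuple \<open>(A\<^sub>1, J\<^bsub>1,1\<^esub>, J\<^bsub>1,2\<^esub>, \<dots>, J\<^bsub>p,p\<^esub>)\<close>, with indices in lexicographic order.\<close>

definition block_tuple ::
    "nat \<Rightarrow> (nat \<Rightarrow> real ^ 'v) \<Rightarrow> real ^ 'v ^ 'v \<Rightarrow> (complex ^ 'v ^ 'v::finite) list" where
  "block_tuple p e A =
     map complex_matrix (A # [outer (e i) (e j). i \<leftarrow> [1..<Suc p], j \<leftarrow> [1..<Suc p]])"

lemma length_block_tuple: "length (block_tuple p e A) = 1 + p\<^sup>2"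
  by (simp add: block_tuple_def length_concat o_def sum_list_triv power2_eq_square del: upt_Suc)

end

theory Submission
  imports Defs
begin

text \<open>
  The color of \<open>(i, j)\<close> in round \<open>r\<close> determines the entry \<open>M\<^sup>r $ i $ j\<close> and whether \<open>i = j\<close>. Hence the
  invariant determines the traces of all powers of \<open>M\<close>, and by Newton's identities these determine
  the characteristic polynomial. For a pencil this takes place over the polynomial ring, an
  integral domain of characteristic zero.

  Newton's identities come from comparing the coefficients of \<open>t\<^sup>k\<close> in
  \<open>(tI - M) \<sqdot> adj (tI - M) = \<phi> I\<close>, together with Jacobi's formula \<open>\<phi>' = tr (adj (tI - M))\<close>.
  They give \<open>(k - n) \<phi>\<^sub>k\<close> in terms of power traces and higher coefficients, and \<open>\<phi>\<^sub>n = 1\<close>.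
\<close>

section \<open>The adjugate matrix\<close>

text \<open>Cofactors as determinants of full size: a unit vector in row \<open>b\<close> replaces
  the minor, so no smaller index type is needed.\<close>

definition adjugate :: "'a::comm_ring_1 ^ 'n ^ 'n \<Rightarrow> 'a ^ 'n ^ 'n::finite" where
  "adjugate N = (\<chi> a b. det (\<chi> i. if i = b then axis a 1 else N $ i))"

text \<open>By linearity in row \<open>b\<close>, entry \<open>(c, b)\<close> of the product is the
  determinant of \<open>N\<close> with row \<open>b\<close> overwritten by row \<open>c\<close>. For
  \<open>b = c\<close> this is \<open>det N\<close>; otherwise two rows coincide.\<close>

lemma matrix_mul_adjugate:
  fixes N :: "'a::comm_ring_1 ^ 'n ^ 'n::finite"
  shows "N ** adjugate N = mat (det N)"
proof -
  have "(N ** adjugate N) $ c $ b = mat (det N) $ c $ b" for c b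
  proof -
    have row: "(\<Sum>a\<in>UNIV. N $ c $ a *s axis a 1) = N $ c"
      by (simp add: basis_expansion)
    have "(N ** adjugate N) $ c $ b
        = (\<Sum>a\<in>UNIV. N $ c $ a * det (\<chi> i. if i = b then axis a 1 else N $ i))"
      by (simp add: matrix_matrix_mult_def adjugate_def)
    also have "\<dots> = (\<Sum>a\<in>UNIV. det (\<chi> i. if i = b then N $ c $ a *s axis a 1 else N $ i))"
      by (simp only: det_row_mul)
    also have "\<dots> = det (\<chi> i. if i = b then \<Sum>a\<in>UNIV. N $ c $ a *s axis a 1 else N $ i)"
      using det_linear_row_sum[of UNIV b "\<lambda>_ a. N $ c $ a *s axis a 1" "\<lambda>i. N $ i"] by simp
    also have "\<dots> = det (\<chi> i. if i = b then N $ c else N $ i)"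
      by (simp only: row)
    also have "\<dots> = mat (det N) $ c $ b"
    proof (cases "b = c")
      case True
      then have "(\<chi> i. if i = b then N $ c else N $ i) = N"
        by (simp add: vec_eq_iff)
      with True show ?thesis
        by (simp add: mat_def)
    next
      case False
      then have "det (\<chi> i. if i = b then N $ c else N $ i) = 0"
        by (intro det_identical_rows[of b c]) (simp_all add: row_def)
      with False show ?thesis
        by (simp add: mat_def)
    qed
    finally show ?thesis .
  qed
  then show ?thesis
    by (simp add: vec_eq_iff)
qed

text \<open>The product rule in the Leibniz expansion, with terms grouped by the row whose factor is
  differentiated.\<close>

lemma pderiv_det:
  fixes N :: "'a::idom poly ^ 'n ^ 'n::finite"
  shows "pderiv (det N) = (\<Sum>a\<in>UNIV. det (\<chi> i. if i = a then \<chi> j. pderiv (N $ a $ j) else N $ i))"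
proof -
  let ?P = "{p. p permutes (UNIV :: 'n set)}"
  let ?R = "\<lambda>a i j. if i = a then pderiv (N $ a $ j) else N $ i $ j"
  have split: "(\<Prod>i\<in>UNIV. ?R a i (p i)) = (\<Prod>i\<in>UNIV - {a}. N $ i $ p i) * pderiv (N $ a $ p a)"
    for a :: 'n and p
    by (subst prod.remove[of UNIV a]) (simp_all add: mult.commute)
  have sign: "pderiv (of_int (sign p) * q) = of_int (sign p) * pderiv q"
    for p :: "'n \<Rightarrow> 'n" and q :: "'a poly"
    by (simp add: sign_def pderiv_minus)
  have "pderiv (det N)
      = (\<Sum>p\<in>?P. of_int (sign p) * (\<Sum>a\<in>UNIV. \<Prod>i\<in>UNIV. ?R a i (p i)))"
    by (simp add: det_def sign pderiv_prod split higher_pderiv_sum[where n = 1, simplified])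
  also have "\<dots> = (\<Sum>a\<in>UNIV. \<Sum>p\<in>?P. of_int (sign p) * (\<Prod>i\<in>UNIV. ?R a i (p i)))"
    by (simp add: sum_distrib_left) (rule sum.swap)
  also have "\<dots> = (\<Sum>a\<in>UNIV. det (\<chi> i. if i = a then \<chi> j. pderiv (N $ a $ j) else N $ i))"
    unfolding det_def by (intro sum.cong prod.cong refl arg_cong2[where f = "(*)"]) auto
  finally show ?thesis .
qed

section \<open>Newton's identities\<close>

definition char_matrix :: "'a::comm_ring_1 ^ 'n ^ 'n \<Rightarrow> 'a poly ^ 'n ^ 'n::finite" where
  "char_matrix M = mat [:0, 1:] - (\<chi> a b. [:M $ a $ b:])"

lemma char_matrix_nth: "char_matrix M $ a $ b = (if a = b then [:0, 1:] else 0) - [:M $ a $ b:]"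
  by (simp add: char_matrix_def mat_def)

text \<open>Differentiating row \<open>a\<close> of tI - M leaves the unit vector at
  \<open>a\<close>, so the summands of \<open>pderiv_det\<close> are exactly the diagonal
  cofactors.\<close>

lemma pderiv_det_char_matrix:
  fixes M :: "'a::idom ^ 'n ^ 'n::finite"
  shows "pderiv (det (char_matrix M)) = trace (adjugate (char_matrix M))"
proof -
  have "(\<chi> j. pderiv (char_matrix M $ a $ j)) = axis a 1" for a
    by (auto simp: vec_eq_iff char_matrix_nth axis_def pderiv_diff pderiv_pCons)
  then show ?thesis
    by (simp only: pderiv_det trace_def adjugate_def vec_lambda_beta)
qed

lemma coeff_prod_card:
  assumes "finite S" "\<And>i. i \<in> S \<Longrightarrow> degree (f i) \<le> 1"
  shows "coeff (prod f S) (card S) = (\<Prod>i\<in>S. coeff (f i) 1)"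
  using assms
proof (induction S)
  case (insert x S)
  have deg: "degree (prod f S) \<le> card S"
    using degree_prod_sum_le[OF \<open>finite S\<close>, of f] sum_mono[of S "\<lambda>i. degree (f i)" "\<lambda>_. 1"] insert.prems
    by fastforce
  have "coeff (f x * prod f S) (1 + card S) = coeff (f x) 1 * coeff (prod f S) (card S)"
  proof -
    have "degree (f x) \<le> 1"
      using insert.prems by simp
    then have "f x = [:coeff (f x) 0, coeff (f x) 1:]"
      by (auto simp: poly_eq_iff coeff_pCons coeff_eq_0 split: nat.split)
    then have "coeff (f x * prod f S) (1 + card S)
        = coeff ([:coeff (f x) 0, coeff (f x) 1:] * prod f S) (1 + card S)"
      by (rule arg_cong)
    \<comment> \<open>The constant coefficient of \<open>f x\<close> meets a coefficient of
      \<open>prod f S\<close> beyond its degree, so only the linear one contributes.\<close>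
    then show ?thesis
      using deg by (simp add: coeff_eq_0)
  qed
  with insert show ?case
    by simp
qed simp

text \<open>Taking the coefficient of t^n in each Leibniz term replaces every entry by its linear
  coefficient, an entry of the identity matrix.\<close>

lemma coeff_det_char_matrix_card:
  fixes M :: "'a::comm_ring_1 ^ 'n ^ 'n::finite"
  shows "coeff (det (char_matrix M)) CARD('n) = 1"
proof -
  have deg: "degree (char_matrix M $ i $ j) \<le> 1" for i j
    by (simp add: char_matrix_nth degree_diff_le)
  have prod: "coeff (\<Prod>i\<in>UNIV. char_matrix M $ i $ p i) CARD('n)
      = (\<Prod>i\<in>UNIV. (mat 1 :: 'a ^ 'n ^ 'n) $ i $ p i)" for p
    by (subst coeff_prod_card) (auto simp: deg char_matrix_nth mat_def intro!: prod.cong)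
  have sign: "coeff (of_int (sign p) * q) k = of_int (sign p) * coeff q k"
    for p :: "'n \<Rightarrow> 'n" and q :: "'a poly" and k
    by (simp add: sign_def)
  have "coeff (det (char_matrix M)) CARD('n) = det (mat 1 :: 'a ^ 'n ^ 'n)"
    unfolding det_def by (simp only: coeff_sum sign prod)
  then show ?thesis
    by simp
qed

text \<open>Views the adjugate of tI - M as a polynomial in t with matrix coefficients B_k.\<close>

definition adjugate_coeff :: "'a::comm_ring_1 ^ 'n ^ 'n \<Rightarrow> nat \<Rightarrow> 'a ^ 'n ^ 'n::finite" where
  "adjugate_coeff M k = (\<chi> a b. coeff (adjugate (char_matrix M) $ a $ b) k)"

lemma coeff_char_matrix_mul:
  fixes M :: "'a::comm_ring_1 ^ 'n ^ 'n::finite"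
  shows "(case k of 0 \<Rightarrow> 0 | Suc l \<Rightarrow> adjugate_coeff M l) - M ** adjugate_coeff M k
    = mat (coeff (det (char_matrix M)) k)"
proof -
  let ?B = "adjugate (char_matrix M)"
  have "(\<Sum>m\<in>UNIV. char_matrix M $ a $ m * ?B $ m $ b)
      = [:0, 1:] * ?B $ a $ b - (\<Sum>m\<in>UNIV. [:M $ a $ m:] * ?B $ m $ b)" for a b
    by (simp add: char_matrix_nth left_diff_distrib sum_subtractf if_distrib[of "\<lambda>x. x * _"]
        cong: if_cong)
  then have "[:0, 1:] * ?B $ a $ b - (\<Sum>m\<in>UNIV. [:M $ a $ m:] * ?B $ m $ b)
      = mat (det (char_matrix M)) $ a $ b" for a b
    using matrix_mul_adjugate[of "char_matrix M"]
    by (simp add: matrix_matrix_mult_def vec_eq_iff)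
  then have "coeff ([:0, 1:] * ?B $ a $ b - (\<Sum>m\<in>UNIV. [:M $ a $ m:] * ?B $ m $ b)) k
      = (if a = b then coeff (det (char_matrix M)) k else 0)" for a b
    by (simp add: mat_def)
  then have "((case k of 0 \<Rightarrow> 0 | Suc l \<Rightarrow> adjugate_coeff M l) - M ** adjugate_coeff M k) $ a $ b
      = mat (coeff (det (char_matrix M)) k) $ a $ b" for a b
    by (cases k) (simp_all add: adjugate_coeff_def matrix_matrix_mult_def coeff_sum mat_def)
  then show ?thesis
    by (simp add: vec_eq_iff)
qed

lemma adjugate_coeff_eventually_0: "eventually (\<lambda>k. adjugate_coeff M k = 0) sequentially"
proof -
  have "eventually (\<lambda>k. coeff (adjugate (char_matrix M) $ a $ b) k = 0) sequentially" for a b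
    unfolding eventually_sequentially
    by (rule exI[of _ "Suc (degree (adjugate (char_matrix M) $ a $ b))"]) (simp add: coeff_eq_0)
  then have "eventually (\<lambda>k. \<forall>a b. coeff (adjugate (char_matrix M) $ a $ b) k = 0) sequentially"
    by (simp add: eventually_all_finite)
  then show ?thesis
    by (simp add: vec_eq_iff adjugate_coeff_def)
qed

lemma funpow_matrix_mul: "((**) M ^^ j) X = ((**) M ^^ j) (mat 1) ** X"
  for M X :: "'a::comm_semiring_1 ^ 'n ^ 'n::finite"
  by (induction j) (simp_all add: matrix_mul_assoc)

lemma trace_matrix_mul_mat: "trace (X ** mat c) = c * trace X"
  for X :: "'a::comm_semiring_1 ^ 'n ^ 'n::finite"
  by (simp add: trace_def matrix_matrix_mult_def mat_def sum_distrib_left mult.commute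
      if_distrib[of "\<lambda>x. _ * x"] cong: if_cong)

theorem det_char_matrix_eq_if_trace_powers_eq:
  fixes M N :: "'a::{idom, ring_char_0} ^ 'n ^ 'n::finite"
  assumes tr: "\<And>j. trace (((**) M ^^ j) (mat 1)) = trace (((**) N ^^ j) (mat 1))"
  shows "det (char_matrix M) = det (char_matrix N)"
proof -
  define c where "c = (\<lambda>M :: 'a ^ 'n ^ 'n. coeff (det (char_matrix M)))"
  \<comment> \<open>The traces tr (M^j B_k) are taken for all \<open>j\<close> at once, because the
    recursion lowers \<open>k\<close> at the price of raising \<open>j\<close>.\<close>
  define T where "T = (\<lambda>(M :: 'a ^ 'n ^ 'n) j k. trace (((**) M ^^ j) (adjugate_coeff M k)))"
  have T_rec: "T M j k = T M (Suc j) (Suc k) + c M (Suc k) * trace (((**) M ^^ j) (mat 1))"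
    for M j k
  proof -
    have "adjugate_coeff M k = M ** adjugate_coeff M (Suc k) + mat (c M (Suc k))"
      using coeff_char_matrix_mul[of M "Suc k"] by (simp add: c_def algebra_simps)
    then have "T M j k = trace (((**) M ^^ j) (M ** adjugate_coeff M (Suc k)))
        + trace (((**) M ^^ j) (mat 1) ** mat (c M (Suc k)))"
      by (simp add: T_def funpow_matrix_mul[of j M "_ + _"] funpow_matrix_mul[of j M "_ ** _"]
          matrix_add_ldistrib trace_add)
    then show ?thesis
      by (simp add: T_def trace_matrix_mul_mat funpow_swap1)
  qed
  have T_deriv: "T M 0 k = of_nat (Suc k) * c M (Suc k)" for M k
    using arg_cong[OF pderiv_det_char_matrix[of M], of "\<lambda>p. coeff p k"]
    by (simp add: T_def c_def trace_def adjugate_coeff_def coeff_sum coeff_pderiv)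
  have newton: "(of_nat (Suc k) - of_nat CARD('n)) * c M (Suc k) = T M 1 (Suc k)" for M k
    using T_rec[of M 0 k] by (simp add: T_deriv trace_I algebra_simps)
  \<comment> \<open>At index 0 no B_(-1) occurs, so \<open>T_rec\<close> does not reach this
    coefficient; the trace of -M B_0 = c_0 I does.\<close>
  have newton_0: "of_nat CARD('n) * c M 0 = - T M 1 0" for M
  proof -
    have "M ** adjugate_coeff M 0 = - mat (c M 0)"
      using arg_cong[OF coeff_char_matrix_mul[of M 0], of uminus] by (simp add: c_def)
    then show ?thesis
      by (simp add: T_def trace_def mat_def sum_negf)
  qed
  have c_card: "c M CARD('n) = 1" for M
    by (simp add: c_def coeff_det_char_matrix_card)
  \<comment> \<open>Downward induction on \<open>k\<close>: B_k vanishes for large \<open>k\<close>,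
    and Jacobi's formula pairs B_k with the coefficient at \<open>Suc k\<close>.\<close>
  define P where "P k \<longleftrightarrow> c M (Suc k) = c N (Suc k) \<and> (\<forall>j. T M j k = T N j k)" for k
  obtain K where K: "\<And>k. k \<ge> K \<Longrightarrow> adjugate_coeff M k = 0 \<and> adjugate_coeff N k = 0"
    using eventually_conj[OF adjugate_coeff_eventually_0[of M] adjugate_coeff_eventually_0[of N]]
    unfolding eventually_sequentially by blast
  have T_0: "T M j k = 0 \<and> T N j k = 0" if "k \<ge> K" for j k
    using K[OF that] funpow_matrix_mul[of j M 0] funpow_matrix_mul[of j N 0]
    by (simp add: T_def trace_def)
  have base: "P k" if "k \<ge> K" for k
    using T_0[OF that] T_deriv[of M k] T_deriv[of N k]
    by (simp add: P_def del: of_nat_Suc)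
  have step: "P k" if "P (Suc k)" for k
  proof -
    have "c M (Suc k) = c N (Suc k)"
    \<comment> \<open>Newton's factor k + 1 - n can be cancelled except at the leading coefficient,
      which is 1 for both matrices.\<close>
    proof (cases "Suc k = CARD('n)")
      case False
      then have "of_nat (Suc k) - of_nat CARD('n) \<noteq> (0 :: 'a)"
        by (simp only: right_minus_eq of_nat_eq_iff not_False_eq_True)
      moreover have "(of_nat (Suc k) - of_nat CARD('n)) * c M (Suc k)
          = (of_nat (Suc k) - of_nat CARD('n)) * c N (Suc k)"
        using that by (simp only: newton P_def)
      ultimately show ?thesis
        by (rule mult_left_cancel[THEN iffD1])
    qed (simp add: c_card)
    then show ?thesis
      using that by (simp add: P_def T_rec[of _ _ k] tr)
  qed
  have P: "P k" for k
  proof (cases "k \<ge> K")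
    case False
    then have "k \<le> K" by simp
    then show ?thesis
      by (induction rule: inc_induct) (use base step in auto)
  qed (rule base)
  have "of_nat CARD('n) * c M 0 = of_nat CARD('n) * c N 0"
    using P[of 0] by (simp only: newton_0 P_def)
  then have "c M 0 = c N 0"
    by simp
  moreover have "c M (Suc k) = c N (Suc k)" for k
    using P by (simp add: P_def)
  ultimately have "c M k = c N k" for k
    by (cases k) simp_all
  then show ?thesis
    by (simp add: c_def poly_eq_iff)
qed

section \<open>Decoding colors\<close>

text \<open>The decoder \<open>f\<close> is chosen before the matrix, so it serves two matrices
  alike. In the induction, each multiset element supplies one summand of M times the previous power:
  the atomic type holds the entry at \<open>(i, m)\<close>, the last color the power's entry at
  \<open>(m, j)\<close>.\<close>

lemma wl2_determines_power:
  "\<exists>f. \<forall>(M :: 'a::comm_ring_1 ^ 'v ^ 'v::finite) i j.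
     ((**) M ^^ Suc r) (mat 1) $ i $ j = f (wl2 M (Suc r) i j)"
proof (induction r)
  case 0
  show ?case
    by (rule exI[of _ "\<lambda>x. case x of Atomic t \<Rightarrow> snd (t ! 0 ! 1) | _ \<Rightarrow> 0"])
      (simp add: atomic_type_def)
next
  case (Suc r)
  then obtain f where f: "\<And>(M :: 'a ^ 'v ^ 'v) i j.
      ((**) M ^^ Suc r) (mat 1) $ i $ j = f (wl2 M (Suc r) i j)"
    by blast
  have "((**) M ^^ Suc (Suc r)) (mat 1) $ i $ j
      = (\<Sum>m\<in>UNIV. M $ i $ m * f (wl2 M (Suc r) m j))" for M :: "'a ^ 'v ^ 'v" and i j
    unfolding funpow.simps(2)[of "Suc r"] o_apply
    by (simp only: matrix_matrix_mult_def f vec_lambda_beta)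
  then show ?case
    \<comment> \<open>Position \<open>0, 2\<close> in the type of \<open>[i, j, m]\<close> belongs
      to the pair \<open>(i, m)\<close>. The default 0 is never reached, as colors after the first
      round are \<open>Refined\<close>.\<close>
    by (intro exI[of _ "\<lambda>x. case x of
        Refined _ S \<Rightarrow> \<Sum>\<^sub># (image_mset (\<lambda>(t, _, y). snd (t ! 0 ! 2) * f y) S) | _ \<Rightarrow> 0"])
      (simp add: atomic_type_def image_mset.compositionality o_def sum_unfold_sum_mset)
qed

text \<open>The equality flag of the first atomic type survives in the first component of every
  later color.\<close>

lemma wl2_determines_diagonal:
  "\<exists>f. \<forall>(M :: 'a ^ 'v ^ 'v::finite) i j. (i = j) = f (wl2 M (Suc r) i j)"
proof (induction r)
  case 0
  show ?case
    by (rule exI[of _ "\<lambda>x. case x of Atomic t \<Rightarrow> fst (t ! 0 ! 1) = 0 | _ \<Rightarrow> False"])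
      (simp add: atomic_type_def)
next
  case (Suc r)
  then obtain f where "\<And>(M :: 'a ^ 'v ^ 'v) i j. (i = j) = f (wl2 M (Suc r) i j)"
    by blast
  then show ?case
    by (intro exI[of _ "\<lambda>x. case x of Refined y _ \<Rightarrow> f y | _ \<Rightarrow> False"]) simp
qed

lemma trace_power_eq_if_wl2_multiset_eq:
  fixes M N :: "'a::comm_ring_1 ^ 'v ^ 'v::finite"
  assumes "wl2_multiset M (Suc r) = wl2_multiset N (Suc r)"
  shows "trace (((**) M ^^ Suc r) (mat 1)) = trace (((**) N ^^ Suc r) (mat 1))"
proof -
  obtain f where f: "\<And>(M :: 'a ^ 'v ^ 'v) i j.
      ((**) M ^^ Suc r) (mat 1) $ i $ j = f (wl2 M (Suc r) i j)"
    using wl2_determines_power by blast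
  obtain g where g: "\<And>(M :: 'a ^ 'v ^ 'v) i j. (i = j) = g (wl2 M (Suc r) i j)"
    using wl2_determines_diagonal by blast
  \<comment> \<open>Summing \<open>h\<close> over the colors of all pairs keeps only the diagonal
    entries of the power, that is, its trace.\<close>
  define h where "h x = (if g x then f x else 0)" for x
  have "trace (((**) M ^^ Suc r) (mat 1)) = \<Sum>\<^sub># (image_mset h (wl2_multiset M (Suc r)))"
    for M :: "'a ^ 'v ^ 'v"
  proof -
    have "trace (((**) M ^^ Suc r) (mat 1))
        = (\<Sum>i\<in>UNIV. \<Sum>j\<in>UNIV. if i = j then ((**) M ^^ Suc r) (mat 1) $ i $ j else 0)"
      by (simp add: trace_def)
    also have "\<dots> = (\<Sum>i\<in>UNIV. \<Sum>j\<in>UNIV. h (wl2 M (Suc r) i j))"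
      by (simp only: h_def f g[of _ _ M, symmetric])
    also have "\<dots> = (\<Sum>x\<in>UNIV. h (wl2 M (Suc r) (fst x) (snd x)))"
      by (simp add: sum.cartesian_product case_prod_unfold)
    also have "\<dots> = \<Sum>\<^sub># (image_mset h (wl2_multiset M (Suc r)))"
      by (simp add: wl2_multiset_def image_mset.compositionality o_def sum_unfold_sum_mset)
    finally show ?thesis .
  qed
  with assms show ?thesis
    by simp
qed

lemma wl2_multiset_eq_if_wl2_invariant_eq:
  assumes "wl2_invariant M = wl2_invariant N"
  shows "wl2_multiset M (Suc r) = wl2_multiset N (Suc r)"
  using arg_cong[OF assms, of "\<lambda>F. fps_nth F (Suc r)"] by (simp add: wl2_invariant_def)

lemma det_char_matrix_eq_if_wl2_invariant_eq:
  fixes M N :: "'a::{idom, ring_char_0} ^ 'v ^ 'v::finite"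
  assumes "wl2_invariant M = wl2_invariant N"
  shows "det (char_matrix M) = det (char_matrix N)"
proof (rule det_char_matrix_eq_if_trace_powers_eq)
  fix j
  show "trace (((**) M ^^ j) (mat 1)) = trace (((**) N ^^ j) (mat 1))"
  \<comment> \<open>Round \<open>Suc r\<close> yields the power \<open>Suc r\<close>; the zeroth
    power has the order of the matrix as its trace on both sides.\<close>
  proof (cases j)
    case (Suc r)
    then show ?thesis
      using trace_power_eq_if_wl2_multiset_eq wl2_multiset_eq_if_wl2_invariant_eq[OF assms] by blast
  qed simp
qed

theorem theorem3p4:
  fixes A\<^sub>1 B\<^sub>1 :: "real ^ 'v ^ 'v::finite"
    and p :: nat
    and e :: "nat \<Rightarrow> real ^ 'v"
  assumes "transpose A\<^sub>1 = A\<^sub>1"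
    and "transpose B\<^sub>1 = B\<^sub>1"
    and "\<forall>i\<in>{1..p}. \<forall>v. e i $ v \<in> {0, 1}"
    and "\<forall>i\<in>{1..p}. \<forall>j\<in>{1..p}. i \<noteq> j \<longrightarrow> {v. e i $ v \<noteq> 0} \<inter> {v. e j $ v \<noteq> 0} = {}"
    and "wl2_invariant (pencil (block_tuple p e A\<^sub>1)) = wl2_invariant (pencil (block_tuple p e B\<^sub>1))"
  shows "pencil_charpoly (block_tuple p e A\<^sub>1) = pencil_charpoly (block_tuple p e B\<^sub>1)"
  using det_char_matrix_eq_if_wl2_invariant_eq[OF assms(5)]
  by (simp add: pencil_charpoly_def char_matrix_def)

end
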